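(* Let $\mathcal{G}_d$ be a directed graph on $n$ vertices with leader set $\mathfrak{S}$, and suppose that every follower can be reached through a directed path from some leader. Label the followers $v_1,\dots,v_{n-|\mathfrak{S}|}$, let $\Delta_i$ and $\delta_i$ be the in-degree and out-degree of $v_i$ in $\mathcal{G}_d$, and let $\Gamma_i$ be the number of leaders having a directed edge to $v_i$. Let $\sigma_1(\mathcal{L}_{g,d})$ be the smallest singular value of the grounded Laplacian $\mathcal{L}_{g,d}$. Then $$\max\left\{0,\ \min_{1\le i\le n-|\mathfrak{S}|}\tfrac12\left(\Delta_i-\delta_i+\Gamma_i\right)\right\}\le\sigma_1(\mathcal{L}_{g,d})\le\min\left\{\left(\frac{1}{n-|\mathfrak{S}|}\sum_{i=1}^{n-|\mathfrak{S}|}\Gamma_i^2\right)^{1/2},\ \left(\min_{1\le i\le n-|\mathfrak{S}|}\{\Delta_i^2+\delta_i\}\right)^{1/2}\right\}.$$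
   Context: Directed graphs $\mathcal{G}_d=(\mathcal{V},\mathcal{E})$ are finite, simple, unweighted and unidirectional: if there is an edge from $v_i$ to $v_j$ then there is none from $v_j$ to $v_i$. The adjacency matrix $A$ has $A_{ij}=1$ if there is a directed edge from $v_j$ to $v_i$ and $A_{ij}=0$ otherwise. The in-degree is $\Delta_i=\sum_j A_{ij}$ and the out-degree is $\delta_i=\sum_j A_{ji}$ (sums over all vertices). The Laplacian is $\mathcal{L}=D-A$ with $D=\mathrm{diag}(\Delta_1,\dots,\Delta_n)$. The leader set $\mathfrak{S}\subset\mathcal{V}$ is a nonempty set of vertices of in-degree zero; the remaining vertices $\mathcal{V}\setminus\mathfrak{S}\ne\emptyset$ are the followers. The grounded Laplacian $\mathcal{L}_{g,d}$ is obtained from $\mathcal{L}$ by deleting the rows and columns of the leaders. *)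

theory Defs
  imports
    Complex_Main
    "Graph_Theory.Digraph"
    "Jordan_Normal_Form.Char_Poly"
    "Jordan_Normal_Form.DL_Submatrix"
begin

(* Matrices of a digraph refer to an enumeration vs of its vertices: row and column i belong
   to vs ! i.  The entry (i, j) of the adjacency matrix records the edge from vs ! j to vs ! i,
   so that row sums are in-degrees. *)
definition adjacency_matrix :: "('a, 'b) pre_digraph \<Rightarrow> 'a list \<Rightarrow> real mat" where
  "adjacency_matrix G vs =
     mat (length vs) (length vs) (\<lambda>(i, j). if vs ! j \<rightarrow>\<^bsub>G\<^esub> vs ! i then 1 else 0)"

definition in_degree_matrix :: "('a, 'b) pre_digraph \<Rightarrow> 'a list \<Rightarrow> real mat" where
  "in_degree_matrix G vs =
     mat (length vs) (length vs) (\<lambda>(i, j). if i = j then real (in_degree G (vs ! i)) else 0)"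

definition laplacian :: "('a, 'b) pre_digraph \<Rightarrow> 'a list \<Rightarrow> real mat" where
  "laplacian G vs = in_degree_matrix G vs - adjacency_matrix G vs"

definition grounded_laplacian :: "('a, 'b) pre_digraph \<Rightarrow> 'a list \<Rightarrow> 'a set \<Rightarrow> real mat" where
  "grounded_laplacian G vs S =
     (let F = {i. i < length vs \<and> vs ! i \<notin> S} in submatrix (laplacian G vs) F F)"

definition leader_degree :: "('a, 'b) pre_digraph \<Rightarrow> 'a set \<Rightarrow> 'a \<Rightarrow> nat" where
  "leader_degree G S u = card {s \<in> S. s \<rightarrow>\<^bsub>G\<^esub> u}"

definition singular_values :: "real mat \<Rightarrow> real set" where
  "singular_values M = {sqrt l | l. eigenvalue (transpose_mat M * M) l}"

(* Only meaningful for nonempty M: otherwise Min is applied to the empty set. *)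
definition smallest_singular_value :: "real mat \<Rightarrow> real" where
  "smallest_singular_value M = Min (singular_values M)"

(* The library counts arcs; in a digraph without parallel arcs this gives the row and column
   sums of the adjacency matrix. *)
lemma (in digraph) in_degree_eq_row_sum:
  assumes "distinct vs" "set vs = verts G" "i < length vs"
  shows "real (in_degree G (vs ! i)) = (\<Sum>j < length vs. adjacency_matrix G vs $$ (i, j))"
proof -
  have "bij_betw (tail G) (in_arcs G (vs ! i)) {u \<in> verts G. u \<rightarrow>\<^bsub>G\<^esub> vs ! i}"
    unfolding bij_betw_def inj_on_def
    by (auto simp: arcs_ends_def arc_to_ends_def image_iff intro!: no_multi_arcs)
  then have "in_degree G (vs ! i) = card {u \<in> verts G. u \<rightarrow>\<^bsub>G\<^esub> vs ! i}"
    unfolding in_degree_def by (rule bij_betw_same_card)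
  also have "\<dots> = card {j. j < length vs \<and> vs ! j \<rightarrow>\<^bsub>G\<^esub> vs ! i}"
    unfolding assms(2)[symmetric] using assms(1)
    by (intro bij_betw_same_card[symmetric, of "(!) vs"])
       (auto simp: bij_betw_def inj_on_def nth_eq_iff_index_eq in_set_conv_nth image_iff)
  finally show ?thesis
    using assms(3) by (simp add: adjacency_matrix_def sum.If_cases Int_def)
qed

lemma (in digraph) out_degree_eq_column_sum:
  assumes "distinct vs" "set vs = verts G" "i < length vs"
  shows "real (out_degree G (vs ! i)) = (\<Sum>j < length vs. adjacency_matrix G vs $$ (j, i))"
proof -
  have "bij_betw (head G) (out_arcs G (vs ! i)) {u \<in> verts G. vs ! i \<rightarrow>\<^bsub>G\<^esub> u}"
    unfolding bij_betw_def inj_on_def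
    by (auto simp: arcs_ends_def arc_to_ends_def image_iff intro!: no_multi_arcs) metis
  then have "out_degree G (vs ! i) = card {u \<in> verts G. vs ! i \<rightarrow>\<^bsub>G\<^esub> u}"
    unfolding out_degree_def by (rule bij_betw_same_card)
  also have "\<dots> = card {j. j < length vs \<and> vs ! i \<rightarrow>\<^bsub>G\<^esub> vs ! j}"
    unfolding assms(2)[symmetric] using assms(1)
    by (intro bij_betw_same_card[symmetric, of "(!) vs"])
       (auto simp: bij_betw_def inj_on_def nth_eq_iff_index_eq in_set_conv_nth image_iff)
  finally show ?thesis
    using assms(3) by (simp add: adjacency_matrix_def sum.If_cases Int_def)
qed

end

theory Submission
  imports
    Defs
    "Jordan_Normal_Form.Spectral_Radius"
begin

text \<open>For a symmetric matrix the infimum of the Rayleigh quotient is an eigenvalue, so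
  \<open>\<sigma>\<^sub>1\<^sup>2\<close> is the minimum of \<open>\<parallel>L x\<parallel>\<^sup>2 / \<parallel>x\<parallel>\<^sup>2\<close>. The upper bounds are this quotient at the
  all-ones vector, where the row sums of the grounded Laplacian are the numbers \<open>\<Gamma>\<^sub>i\<close>, and at the
  unit vectors. For the lower bound, \<open>x\<^sup>T L x \<le> \<sigma>\<^sub>1 \<parallel>x\<parallel>\<^sup>2\<close> at a minimizer \<open>x\<close>, while
  \<open>2 x\<^sub>i x\<^sub>j \<le> x\<^sub>i\<^sup>2 + x\<^sub>j\<^sup>2\<close> bounds \<open>x\<^sup>T L x\<close> below by
  \<open>\<Sum>\<^sub>i (\<Delta>\<^sub>i - \<delta>\<^sub>i + \<Gamma>\<^sub>i) x\<^sub>i\<^sup>2 / 2\<close>.\<close>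

section \<open>Rayleigh quotients of symmetric real matrices\<close>

text \<open>Each product of two coordinates is at most \<open>x \<bullet> x\<close> in absolute
  value, so the sum of the absolute values of the entries is already a bound. This crude constant
  suffices, since only its existence matters later.\<close>

lemma quadratic_form_bounded:
  fixes P :: "real mat"
  assumes "P \<in> carrier_mat m m"
  obtains K where "K > 0" "\<And>x. x \<in> carrier_vec m \<Longrightarrow> \<bar>x \<bullet> (P *\<^sub>v x)\<bar> \<le> K * (x \<bullet> x)"
proof
  let ?K = "\<Sum>i<m. \<Sum>j<m. \<bar>P $$ (i, j)\<bar>"
  \<comment> \<open>The summand 1 makes the constant positive even for the zero matrix, so that
    \<open>1 / K\<close> can be formed.\<close>
  show "1 + ?K > 0"
    by (intro add_pos_nonneg sum_nonneg) auto
  fix x :: "real vec"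
  assume x: "x \<in> carrier_vec m"
  have sq: "(x $ i)\<^sup>2 \<le> x \<bullet> x" if "i < m" for i
    using x that member_le_sum[of i "{..<m}" "\<lambda>i. (x $ i)\<^sup>2"]
    by (simp add: scalar_prod_def power2_eq_square atLeast0LessThan)
  have "x \<bullet> (P *\<^sub>v x) = (\<Sum>i<m. \<Sum>j<m. P $$ (i, j) * (x $ i * x $ j))"
    using assms x by (simp add: scalar_prod_def atLeast0LessThan sum_distrib_left algebra_simps)
  also have "\<bar>\<dots>\<bar> \<le> (\<Sum>i<m. \<bar>\<Sum>j<m. P $$ (i, j) * (x $ i * x $ j)\<bar>)"
    by (rule sum_abs)
  also have "\<dots> \<le> (\<Sum>i<m. \<Sum>j<m. \<bar>P $$ (i, j) * (x $ i * x $ j)\<bar>)"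
    by (intro sum_mono sum_abs)
  also have "\<dots> \<le> (\<Sum>i<m. \<Sum>j<m. \<bar>P $$ (i, j)\<bar> * (x \<bullet> x))"
  proof (intro sum_mono)
    fix i j assume "i \<in> {..<m}" "j \<in> {..<m}"
    then have "(x $ i)\<^sup>2 \<le> x \<bullet> x" "(x $ j)\<^sup>2 \<le> x \<bullet> x"
      using sq by auto
    moreover have "2 * \<bar>x $ i * x $ j\<bar> \<le> (x $ i)\<^sup>2 + (x $ j)\<^sup>2"
      using sum_squares_bound[of "\<bar>x $ i\<bar>" "\<bar>x $ j\<bar>"] by (simp add: abs_mult)
    ultimately have "\<bar>x $ i * x $ j\<bar> \<le> x \<bullet> x" by linarith
    then show "\<bar>P $$ (i, j) * (x $ i * x $ j)\<bar> \<le> \<bar>P $$ (i, j)\<bar> * (x \<bullet> x)"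
      by (simp add: abs_mult[of "P $$ (i, j)"] mult_left_mono)
  qed
  also have "\<dots> = ?K * (x \<bullet> x)"
    by (simp add: sum_distrib_right)
  also have "\<dots> \<le> (1 + ?K) * (x \<bullet> x)"
    using x by (simp add: algebra_simps scalar_prod_def sum_nonneg)
  finally show "\<bar>x \<bullet> (P *\<^sub>v x)\<bar> \<le> (1 + ?K) * (x \<bullet> x)" .
qed

lemma scalar_prod_self_pos:
  fixes x :: "real vec"
  assumes "x \<in> carrier_vec m" "x \<noteq> 0\<^sub>v m"
  shows "x \<bullet> x > 0"
proof -
  obtain i where "i < m" "x $ i \<noteq> 0"
    using assms by (metis carrier_vecD eq_vecI index_zero_vec)
  then show ?thesis
    using assms(1) unfolding scalar_prod_def
    by (intro sum_pos2[where i = i]) (auto simp: less_le)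
qed

text \<open>No diagonalization is involved: with \<open>K\<close> bounding the form of the inverse
  of \<open>C\<close>, semidefiniteness at one well-chosen vector yields coercivity with constant
  \<open>1 / K\<close>.\<close>

lemma nonsingular_psd_coercive:
  fixes C :: "real mat"
  assumes C: "C \<in> carrier_mat m m" and sym: "transpose_mat C = C" and det: "det C \<noteq> 0"
    and psd: "\<And>x. x \<in> carrier_vec m \<Longrightarrow> x \<bullet> (C *\<^sub>v x) \<ge> 0"
  obtains d where "d > 0" "\<And>x. x \<in> carrier_vec m \<Longrightarrow> d * (x \<bullet> x) \<le> x \<bullet> (C *\<^sub>v x)"
proof -
  obtain P where P: "P \<in> carrier_mat m m" and CP: "C * P = 1\<^sub>m m"
    using det_non_zero_imp_unit[OF C det, of "()"]
    by (auto simp: Units_def ring_mat_def)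
  obtain K where K: "K > 0" "\<And>x. x \<in> carrier_vec m \<Longrightarrow> \<bar>x \<bullet> (P *\<^sub>v x)\<bar> \<le> K * (x \<bullet> x)"
    using quadratic_form_bounded[OF P] by blast
  have "1 / K * (x \<bullet> x) \<le> x \<bullet> (C *\<^sub>v x)" if x: "x \<in> carrier_vec m" for x
  proof -
    define y where "y = P *\<^sub>v x"
    have y: "y \<in> carrier_vec m" using P x by (simp add: y_def)
    have Cy: "C *\<^sub>v y = x"
      using C P x CP by (simp add: y_def assoc_mult_mat_vec[symmetric])
    \<comment> \<open>For \<open>x - t y\<close> with \<open>C y = x\<close>, the form of
      \<open>C\<close> is at most its value at \<open>x\<close> plus \<open>(K t^2 - 2 t)\<close>
      times \<open>x \<bullet> x\<close>. The choice \<open>t = 1 / K\<close> minimizes this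
      bound.\<close>
    define z where "z = x - (1 / K) \<cdot>\<^sub>v y"
    have z: "z \<in> carrier_vec m" using x y by (simp add: z_def)
    have Cz: "C *\<^sub>v z = C *\<^sub>v x - (1 / K) \<cdot>\<^sub>v x"
      using C x y Cy by (simp add: z_def mult_minus_distrib_mat_vec mult_mat_vec)
    have yCx: "y \<bullet> (C *\<^sub>v x) = x \<bullet> x"
      using transpose_vec_mult_scalar[OF C x y] sym Cy C x y by simp
    have yx: "y \<bullet> x \<le> K * (x \<bullet> x)"
      using K(2)[OF x] comm_scalar_prod[OF x y] by (simp add: y_def)
    have "0 \<le> z \<bullet> (C *\<^sub>v z)" by (rule psd[OF z])
    also have "z \<bullet> (C *\<^sub>v z) = x \<bullet> (C *\<^sub>v x) - 2 * (1 / K) * (x \<bullet> x) + (1 / K)\<^sup>2 * (y \<bullet> x)"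
      unfolding Cz using C x y yCx mult_mat_vec_carrier[OF C x]
      by (simp add: z_def minus_scalar_prod_distrib[of _ m] scalar_prod_minus_distrib[of _ m]
          power2_eq_square algebra_simps diff_divide_distrib)
    also have "(1 / K)\<^sup>2 * (y \<bullet> x) \<le> (1 / K)\<^sup>2 * (K * (x \<bullet> x))"
      by (intro mult_left_mono yx) simp
    finally show ?thesis
      using K(1) by (simp add: power2_eq_square)
  qed
  then show thesis using K(1) by (intro that[of "1 / K"]) auto
qed

text \<open>The infimum of the Rayleigh quotient is an eigenvalue: otherwise the shifted form would be
  coercive and the infimum could be raised.\<close>
lemma rayleigh_lower_bound_eigenvalue:
  fixes B :: "real mat"
  assumes B: "B \<in> carrier_mat m m" and sym: "transpose_mat B = B" and m: "m > 0"
  obtains l where "eigenvalue B l" "\<And>x. x \<in> carrier_vec m \<Longrightarrow> l * (x \<bullet> x) \<le> x \<bullet> (B *\<^sub>v x)"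
proof -
  define R where "R = {t. \<forall>x \<in> carrier_vec m. t * (x \<bullet> x) \<le> x \<bullet> (B *\<^sub>v x)}"
  obtain K where K: "\<And>x. x \<in> carrier_vec m \<Longrightarrow> \<bar>x \<bullet> (B *\<^sub>v x)\<bar> \<le> K * (x \<bullet> x)"
    using quadratic_form_bounded[OF B] by blast
  have "- K \<in> R" using K by (force simp: R_def abs_le_iff)
  \<comment> \<open>Any unit vector bounds \<open>R\<close> above by its own Rayleigh quotient;
    \<open>m > 0\<close> guarantees that coordinate 0 exists.\<close>
  define e where "e = (unit_vec m 0 :: real vec)"
  have e: "e \<in> carrier_vec m" "e \<bullet> e = 1" using m by (simp_all add: e_def)
  have bdd: "bdd_above R"
    unfolding bdd_above_def using e by (force simp: R_def)
  define l where "l = Sup R"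
  have l_le: "l * (x \<bullet> x) \<le> x \<bullet> (B *\<^sub>v x)" if x: "x \<in> carrier_vec m" for x
  proof (cases "x = 0\<^sub>v m")
    case True
    then show ?thesis using B by simp
  next
    case False
    have pos: "x \<bullet> x > 0" by (rule scalar_prod_self_pos[OF x False])
    have "l \<le> x \<bullet> (B *\<^sub>v x) / (x \<bullet> x)"
      unfolding l_def
    proof (rule cSup_least)
      show "R \<noteq> {}" using \<open>- K \<in> R\<close> by blast
      show "t \<le> x \<bullet> (B *\<^sub>v x) / (x \<bullet> x)" if "t \<in> R" for t
        using that x pos by (simp add: R_def pos_le_divide_eq)
    qed
    then show ?thesis using pos by (simp add: pos_le_divide_eq)
  qed
  \<comment> \<open>\<open>?C\<close> is \<open>B\<close> minus \<open>l\<close> times the identity.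
    Its form is nonnegative by \<open>l_le\<close>, so coercivity would follow if it were
    nonsingular.\<close>
  let ?C = "char_matrix B l"
  have C: "?C \<in> carrier_mat m m" using B by simp
  have form: "x \<bullet> (?C *\<^sub>v x) = x \<bullet> (B *\<^sub>v x) - l * (x \<bullet> x)" if x: "x \<in> carrier_vec m" for x
  proof -
    have "?C *\<^sub>v x = B *\<^sub>v x - l \<cdot>\<^sub>v x"
      using B x unfolding char_matrix_def
      by (intro eq_vecI) (auto simp: add_mult_distrib_mat_vec[of _ m m])
    then show ?thesis
      using x B mult_mat_vec_carrier[OF B x] by (simp add: scalar_prod_minus_distrib[of _ m])
  qed
  have "det ?C = 0"
  proof (rule ccontr)
    assume "det ?C \<noteq> 0"
    moreover have "transpose_mat ?C = ?C"
    proof -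
      have "transpose_mat (- l \<cdot>\<^sub>m 1\<^sub>m m) = - l \<cdot>\<^sub>m 1\<^sub>m m"
        by (intro eq_matI) auto
      then show ?thesis
        using B sym unfolding char_matrix_def by (simp add: transpose_add[of _ m m])
    qed
    ultimately obtain d where d: "d > 0" "\<And>x. x \<in> carrier_vec m \<Longrightarrow> d * (x \<bullet> x) \<le> x \<bullet> (?C *\<^sub>v x)"
      using nonsingular_psd_coercive[OF C] form l_le by (metis diff_ge_0_iff_ge)
    then have "l + d \<in> R" by (fastforce simp: R_def form algebra_simps)
    then have "l + d \<le> l" unfolding l_def by (intro cSup_upper bdd)
    with d(1) show False by simp
  qed
  then have "eigenvalue B l" using eigenvalue_det[OF B] by simp
  then show thesis using l_le that by blast
qed

section \<open>The smallest singular value as a minimum\<close>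

lemma gram_quadratic_form:
  fixes M :: "real mat"
  assumes M: "M \<in> carrier_mat m m" and x: "x \<in> carrier_vec m"
  shows "x \<bullet> ((transpose_mat M * M) *\<^sub>v x) = (M *\<^sub>v x) \<bullet> (M *\<^sub>v x)"
proof -
  have "x \<bullet> ((transpose_mat M * M) *\<^sub>v x) = x \<bullet> (transpose_mat M *\<^sub>v (M *\<^sub>v x))"
    using M x by (simp add: assoc_mult_mat_vec[of _ m m])
  also have "\<dots> = (transpose_mat M *\<^sub>v (M *\<^sub>v x)) \<bullet> x"
    using M x by (intro comm_scalar_prod[of _ m]) auto
  also have "\<dots> = (M *\<^sub>v x) \<bullet> (M *\<^sub>v x)"
    using M x by (intro transpose_vec_mult_scalar) auto
  finally show ?thesis .
qed

text \<open>The Rayleigh lower bound \<open>l\<close> of \<open>transpose_mat M * M\<close> is an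
  eigenvalue and lies below every other one, so \<open>sqrt l\<close> is the minimum in the
  definition. A corresponding eigenvector attains the bound.\<close>

lemma smallest_singular_value_eigenvector:
  fixes M :: "real mat"
  assumes M: "M \<in> carrier_mat m m" and m: "m > 0"
  obtains x where "x \<in> carrier_vec m" "x \<noteq> 0\<^sub>v m"
    "(M *\<^sub>v x) \<bullet> (M *\<^sub>v x) = (smallest_singular_value M)\<^sup>2 * (x \<bullet> x)"
    "smallest_singular_value M \<ge> 0"
    "\<And>y. y \<in> carrier_vec m \<Longrightarrow>
       (smallest_singular_value M)\<^sup>2 * (y \<bullet> y) \<le> (M *\<^sub>v y) \<bullet> (M *\<^sub>v y)"
proof -
  define B where "B = transpose_mat M * M"
  have B: "B \<in> carrier_mat m m" using M by (simp add: B_def)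
  have sym: "transpose_mat B = B"
    using M by (simp add: B_def transpose_mult[of _ m m])
  obtain l where l: "eigenvalue B l" "\<And>x. x \<in> carrier_vec m \<Longrightarrow> l * (x \<bullet> x) \<le> x \<bullet> (B *\<^sub>v x)"
    using rayleigh_lower_bound_eigenvalue[OF B sym m] by blast
  have ev: "\<exists>x. x \<in> carrier_vec m \<and> x \<noteq> 0\<^sub>v m \<and> (M *\<^sub>v x) \<bullet> (M *\<^sub>v x) = k * (x \<bullet> x)"
    if "eigenvalue B k" for k
  proof -
    from that obtain x where x: "x \<in> carrier_vec m" "x \<noteq> 0\<^sub>v m" "B *\<^sub>v x = k \<cdot>\<^sub>v x"
      using B by (auto simp: eigenvalue_def eigenvector_def)
    then have "(M *\<^sub>v x) \<bullet> (M *\<^sub>v x) = k * (x \<bullet> x)"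
      using gram_quadratic_form[OF M x(1)] by (simp add: B_def)
    with x show ?thesis by blast
  qed
  have ge: "l \<le> k" if k: "eigenvalue B k" for k
  proof -
    obtain x where x: "x \<in> carrier_vec m" "x \<noteq> 0\<^sub>v m" "(M *\<^sub>v x) \<bullet> (M *\<^sub>v x) = k * (x \<bullet> x)"
      using ev[OF k] by blast
    then have "l * (x \<bullet> x) \<le> k * (x \<bullet> x)"
      using l(2)[OF x(1)] gram_quadratic_form[OF M x(1)] by (simp add: B_def)
    then show ?thesis using scalar_prod_self_pos[OF x(1,2)] by simp
  qed
  obtain x where x: "x \<in> carrier_vec m" "x \<noteq> 0\<^sub>v m" "(M *\<^sub>v x) \<bullet> (M *\<^sub>v x) = l * (x \<bullet> x)"
    using ev[OF l(1)] by blast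
  \<comment> \<open>Nonnegativity of \<open>l\<close> is what turns the square of
    \<open>sqrt l\<close> back into \<open>l\<close>.\<close>
  have "0 \<le> (M *\<^sub>v x) \<bullet> (M *\<^sub>v x)"
    unfolding scalar_prod_def by (intro sum_nonneg) simp
  then have l0: "l \<ge> 0"
    using scalar_prod_self_pos[OF x(1,2)] by (simp add: x(3) zero_le_mult_iff)
  have "finite {k. eigenvalue B k}"
    using card_finite_spectrum(1)[OF B] by (simp add: spectrum_def)
  then have "finite (singular_values M)"
    unfolding singular_values_def B_def[symmetric] by simp
  then have "smallest_singular_value M = sqrt l"
    unfolding smallest_singular_value_def using ge l(1)
    by (intro Min_eqI) (auto simp: singular_values_def B_def[symmetric])
  then show thesis
    using x l0 l(2) gram_quadratic_form[OF M] by (intro that[of x]) (auto simp: B_def)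
qed

lemma smallest_singular_value_le:
  fixes M :: "real mat"
  assumes M: "M \<in> carrier_mat m m" and x: "x \<in> carrier_vec m" "x \<bullet> x > 0"
  shows "smallest_singular_value M \<le> sqrt ((M *\<^sub>v x) \<bullet> (M *\<^sub>v x) / (x \<bullet> x))"
proof -
  have "m > 0" using x by (cases m) (auto simp: scalar_prod_def)
  then obtain "(smallest_singular_value M)\<^sup>2 * (x \<bullet> x) \<le> (M *\<^sub>v x) \<bullet> (M *\<^sub>v x)"
    using smallest_singular_value_eigenvector[OF M] x(1) by metis
  then show ?thesis using x(2) by (intro real_le_rsqrt) (simp add: pos_le_divide_eq)
qed

lemma smallest_singular_value_nonneg:
  assumes "M \<in> carrier_mat m m" "m > 0"
  shows "smallest_singular_value M \<ge> 0"
  using smallest_singular_value_eigenvector[OF assms] by blast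

text \<open>At a vector \<open>x\<close> attaining the minimum, \<open>M x\<close> has length
  \<open>s\<close> times that of \<open>x\<close>, so Cauchy-Schwarz gives
  \<open>x \<bullet> (M x) \<le> s (x \<bullet> x)\<close>, to be compared with coercivity.
  \<open>M\<close> may be nonsymmetric, as grounded Laplacians of digraphs are in general.\<close>

lemma smallest_singular_value_ge:
  fixes M :: "real mat"
  assumes M: "M \<in> carrier_mat m m" and m: "m > 0"
    and coercive: "\<And>x. x \<in> carrier_vec m \<Longrightarrow> c * (x \<bullet> x) \<le> x \<bullet> (M *\<^sub>v x)"
  shows "c \<le> smallest_singular_value M"
proof -
  define s where "s = smallest_singular_value M"
  obtain x where x: "x \<in> carrier_vec m" "x \<noteq> 0\<^sub>v m"
    and eq: "(M *\<^sub>v x) \<bullet> (M *\<^sub>v x) = s\<^sup>2 * (x \<bullet> x)" and s0: "s \<ge> 0"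
    unfolding s_def using smallest_singular_value_eigenvector[OF M m] by metis
  have pos: "x \<bullet> x > 0" by (rule scalar_prod_self_pos[OF x])
  show ?thesis
  \<comment> \<open>The Cauchy-Schwarz argument below cancels a factor \<open>s\<close>. For
    \<open>s = 0\<close> the minimizer lies in the kernel of \<open>M\<close>, and coercivity forces
    \<open>c \<le> 0\<close>.\<close>
  proof (cases "s = 0")
    case True
    have "M *\<^sub>v x = 0\<^sub>v m"
      using eq True scalar_prod_self_pos[OF mult_mat_vec_carrier[OF M x(1)]] by force
    then show ?thesis
      using coercive[OF x(1)] x(1) pos True by (simp add: s_def mult_le_0_iff)
  next
    case False
    \<comment> \<open>Since \<open>M x\<close> and \<open>s x\<close> have equal length, expanding
      the square of their difference gives exactly the required Cauchy-Schwarz inequality.\<close>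
    let ?y = "M *\<^sub>v x - s \<cdot>\<^sub>v x"
    have "0 \<le> ?y \<bullet> ?y" unfolding scalar_prod_def by (intro sum_nonneg) simp
    also have "\<dots> = s\<^sup>2 * (x \<bullet> x) - 2 * s * (x \<bullet> (M *\<^sub>v x)) + s\<^sup>2 * (x \<bullet> x)"
      using x(1) mult_mat_vec_carrier[OF M x(1)] comm_scalar_prod[of x m "M *\<^sub>v x"]
      by (simp add: minus_scalar_prod_distrib[of _ m] scalar_prod_minus_distrib[of _ m]
          eq algebra_simps power2_eq_square)
    finally have "s * (x \<bullet> (M *\<^sub>v x)) \<le> s * (s * (x \<bullet> x))"
      by (simp add: power2_eq_square algebra_simps)
    then have "x \<bullet> (M *\<^sub>v x) \<le> s * (x \<bullet> x)" using s0 False by simp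
    with coercive[OF x(1)] have "c * (x \<bullet> x) \<le> s * (x \<bullet> x)" by linarith
    then show ?thesis using pos by (simp add: s_def)
  qed
qed

section \<open>Diagonal dominance of the symmetric part\<close>

text \<open>The inequality between arithmetic and geometric means splits each term
  \<open>a i j * (x $ i * x $ j)\<close> into two halves, one charged to coordinate \<open>i\<close>
  and one to \<open>j\<close>. Coordinate \<open>i\<close> thus pays half its row sum and half its
  column sum.\<close>

lemma quadratic_form_diagonal_minus_ge:
  fixes D :: "nat \<Rightarrow> real"
  assumes a: "\<And>i j. 0 \<le> a i j" and x: "x \<in> carrier_vec m"
    and c: "\<And>i. i < m \<Longrightarrow> c \<le> D i - (\<Sum>j<m. a i j) / 2 - (\<Sum>j<m. a j i) / 2"
  defines "L \<equiv> mat m m (\<lambda>(i, j). (if i = j then D i else 0) - a i j)"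
  shows "c * (x \<bullet> x) \<le> x \<bullet> (L *\<^sub>v x)"
proof -
  have amgm: "a i j * (x $ i * x $ j) \<le> a i j * (x $ i)\<^sup>2 / 2 + a i j * (x $ j)\<^sup>2 / 2" for i j
    using mult_left_mono[OF sum_squares_bound[of "x $ i" "x $ j"] a[of i j]]
    by (simp add: algebra_simps)
  have "c * (x \<bullet> x) = (\<Sum>i<m. c * (x $ i)\<^sup>2)"
    using x by (simp add: scalar_prod_def power2_eq_square atLeast0LessThan sum_distrib_left)
  also have "\<dots> \<le> (\<Sum>i<m. (D i - (\<Sum>j<m. a i j) / 2 - (\<Sum>j<m. a j i) / 2) * (x $ i)\<^sup>2)"
    by (intro sum_mono mult_right_mono c) auto
  also have "\<dots> = (\<Sum>i<m. D i * (x $ i)\<^sup>2) - (\<Sum>i<m. \<Sum>j<m. a i j * (x $ i)\<^sup>2 / 2)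
      - (\<Sum>i<m. \<Sum>j<m. a j i * (x $ i)\<^sup>2 / 2)"
    by (simp add: left_diff_distrib sum_subtractf sum_distrib_right sum_divide_distrib)
  \<comment> \<open>Exchanging the summation order puts the column halves on the weights
    \<open>a i j\<close> as well, ready to pair with the row halves.\<close>
  also have "(\<Sum>i<m. \<Sum>j<m. a j i * (x $ i)\<^sup>2 / 2) = (\<Sum>i<m. \<Sum>j<m. a i j * (x $ j)\<^sup>2 / 2)"
    by (rule sum.swap)
  also have "(\<Sum>i<m. D i * (x $ i)\<^sup>2) - (\<Sum>i<m. \<Sum>j<m. a i j * (x $ i)\<^sup>2 / 2)
      - (\<Sum>i<m. \<Sum>j<m. a i j * (x $ j)\<^sup>2 / 2)
    = (\<Sum>i<m. D i * (x $ i)\<^sup>2) - (\<Sum>i<m. \<Sum>j<m. a i j * (x $ i)\<^sup>2 / 2 + a i j * (x $ j)\<^sup>2 / 2)"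
    by (simp add: sum.distrib)
  also have "\<dots> \<le> (\<Sum>i<m. D i * (x $ i)\<^sup>2) - (\<Sum>i<m. \<Sum>j<m. a i j * (x $ i * x $ j))"
    by (intro diff_left_mono sum_mono amgm)
  also have "\<dots> = (\<Sum>i<m. x $ i * (\<Sum>j<m. ((if i = j then D i else 0) - a i j) * x $ j))"
  proof -
    have "x $ i * (\<Sum>j<m. ((if i = j then D i else 0) - a i j) * x $ j)
        = D i * (x $ i)\<^sup>2 - (\<Sum>j<m. a i j * (x $ i * x $ j))" if "i < m" for i
    proof -
      have "(\<Sum>j<m. (if i = j then D i else 0) * x $ j) = D i * x $ i"
        using that by (simp add: if_distrib[of "\<lambda>t. t * _"] cong: if_cong)
      then show ?thesis
        by (simp add: left_diff_distrib right_diff_distrib sum_subtractf sum_distrib_left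
            power2_eq_square mult_ac)
    qed
    then show ?thesis by (simp add: sum_subtractf)
  qed
  also have "\<dots> = x \<bullet> (L *\<^sub>v x)"
    using x by (simp add: L_def scalar_prod_def atLeast0LessThan)
  finally show ?thesis .
qed

section \<open>Degree sums and the follower block of the Laplacian\<close>

lemma sum_list_index_distinct:
  assumes "distinct xs"
  shows "(\<Sum>i<length xs. f (xs ! i)) = (\<Sum>x\<in>set xs. f x)"
  by (rule sum.reindex_bij_betw[OF bij_betw_nth[OF assms refl refl]])

text \<open>A form free of any enumeration, so that the sum can be split over leaders and followers
  as sets.\<close>

lemma (in digraph) in_degree_eq_sum:
  assumes "u \<in> verts G"
  shows "real (in_degree G u) = (\<Sum>w\<in>verts G. of_bool (w \<rightarrow>\<^bsub>G\<^esub> u))"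
proof -
  obtain vs where vs: "set vs = verts G" "distinct vs"
    using finite_distinct_list[OF finite_verts] by blast
  then obtain i where i: "i < length vs" "vs ! i = u"
    using assms by (metis in_set_conv_nth)
  have "real (in_degree G u) = (\<Sum>j<length vs. of_bool (vs ! j \<rightarrow>\<^bsub>G\<^esub> u))"
    using in_degree_eq_row_sum[OF vs(2,1) i(1)] i
    by (simp add: adjacency_matrix_def of_bool_def)
  then show ?thesis
    using sum_list_index_distinct[OF vs(2), of "\<lambda>w. of_bool (w \<rightarrow>\<^bsub>G\<^esub> u) :: real"] vs(1) by simp
qed

lemma (in digraph) out_degree_eq_sum:
  assumes "u \<in> verts G"
  shows "real (out_degree G u) = (\<Sum>w\<in>verts G. of_bool (u \<rightarrow>\<^bsub>G\<^esub> w))"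
proof -
  obtain vs where vs: "set vs = verts G" "distinct vs"
    using finite_distinct_list[OF finite_verts] by blast
  then obtain i where i: "i < length vs" "vs ! i = u"
    using assms by (metis in_set_conv_nth)
  have "real (out_degree G u) = (\<Sum>j<length vs. of_bool (u \<rightarrow>\<^bsub>G\<^esub> vs ! j))"
    using out_degree_eq_column_sum[OF vs(2,1) i(1)] i
    by (simp add: adjacency_matrix_def of_bool_def)
  then show ?thesis
    using sum_list_index_distinct[OF vs(2), of "\<lambda>w. of_bool (u \<rightarrow>\<^bsub>G\<^esub> w) :: real"] vs(1) by simp
qed

text \<open>The right-hand side applies the same definition to the list of followers only, but still with
  the degrees of the whole graph.\<close>
lemma grounded_laplacian_eq_laplacian_filter:
  "grounded_laplacian G vs S = laplacian G (filter (\<lambda>u. u \<notin> S) vs)"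
proof -
  define F where "F = {i. i < length vs \<and> vs ! i \<notin> S}"
  define v where "v = filter (\<lambda>u. u \<notin> S) vs"
  have v: "v = nths vs F" unfolding v_def F_def by (rule filter_eq_nths)
  have m: "length v = card {i. i < length vs \<and> i \<in> F}"
    by (simp add: v length_nths)
  have nth: "v ! i = vs ! pick F i" if "i < length v" for i
    using nth_nths[of i vs F] that by (simp add: m v[symmetric])
  have lt: "pick F i < length vs" if "i < length v" for i
    using pick_le that m by metis
  have "F = {i. i < length vs \<and> i \<in> F}" by (auto simp: F_def)
  then have cF: "card F = length v" using m by simp
  \<comment> \<open>The diagonal test of the full Laplacian compares picked indices. It agrees with
    the test \<open>i = j\<close> because \<open>i\<close> is recovered as the number of elements of
    \<open>F\<close> below \<open>pick F i\<close>.\<close>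
  have inj: "pick F i = pick F j \<longleftrightarrow> i = j" if "i < length v" "j < length v" for i j
    using that card_pick_le[of i F] card_pick_le[of j F] cF by metis
  have "submatrix (laplacian G vs) F F = laplacian G v"
    by (intro eq_matI)
       (auto simp: dim_submatrix submatrix_index laplacian_def in_degree_matrix_def
         adjacency_matrix_def m[symmetric] lt nth inj)
  then show ?thesis
    by (simp add: grounded_laplacian_def F_def v_def)
qed

theorem theorem3:
  fixes G :: "('a, 'b) pre_digraph" and S :: "'a set" and vs v :: "'a list" and n :: nat
  assumes "digraph G"
    and "\<And>x y. x \<rightarrow>\<^bsub>G\<^esub> y \<Longrightarrow> \<not> y \<rightarrow>\<^bsub>G\<^esub> x"
    and "n = card (verts G)"
    and "S \<subseteq> verts G" and "S \<noteq> {}" and "verts G - S \<noteq> {}"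
    and "\<And>s. s \<in> S \<Longrightarrow> in_degree G s = 0"
    and "\<And>u. u \<in> verts G - S \<Longrightarrow> \<exists>s\<in>S. s \<rightarrow>\<^sup>*\<^bsub>G\<^esub> u"
    and "distinct vs" and "set vs = verts G"
    and "v = filter (\<lambda>u. u \<notin> S) vs"
  shows "max 0 (MIN i\<in>{..<n - card S}.
             1 / 2 * (real (in_degree G (v ! i)) - real (out_degree G (v ! i))
                       + real (leader_degree G S (v ! i))))
           \<le> smallest_singular_value (grounded_laplacian G vs S)
         \<and> smallest_singular_value (grounded_laplacian G vs S)
           \<le> min (sqrt (1 / real (n - card S) *
                        (\<Sum>i<n - card S. (real (leader_degree G S (v ! i)))\<^sup>2)))
                  (sqrt (MIN i\<in>{..<n - card S}.
                        (real (in_degree G (v ! i)))\<^sup>2 + real (out_degree G (v ! i))))"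
proof -
  interpret digraph G by fact
  define m where "m = length v"
  define D where "D i = real (in_degree G (v ! i))" for i
  define a where "a i j = (of_bool (v ! j \<rightarrow>\<^bsub>G\<^esub> v ! i) :: real)" for i j
  let ?\<delta> = "\<lambda>i. real (out_degree G (v ! i))"
  let ?\<Gamma> = "\<lambda>i. real (leader_degree G S (v ! i))"
  define L where "L = mat m m (\<lambda>(i, j). (if i = j then D i else 0) - a i j)"
  have grounded: "grounded_laplacian G vs S = L"
    unfolding grounded_laplacian_eq_laplacian_filter assms(11)[symmetric]
    by (intro eq_matI) (auto simp: laplacian_def in_degree_matrix_def adjacency_matrix_def
        L_def m_def D_def a_def)
  have L: "L \<in> carrier_mat m m" by (simp add: L_def)
  have dist: "distinct v" and setv: "set v = verts G - S"
    using assms(9-11) by auto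
  have finS: "finite S" using finite_subset[OF assms(4)] by simp
  have card: "n - card S = m"
    using distinct_card[OF dist] setv assms(3) card_Diff_subset[OF finS assms(4)]
    by (simp add: m_def)
  have m0: "m > 0" using setv assms(6) by (auto simp: m_def)
  have follower: "v ! i \<in> verts G - S" if "i < m" for i
    using that setv nth_mem by (fastforce simp: m_def)
  \<comment> \<open>Hence every arc leaving a follower ends at a follower, and the columns of the
    follower block keep the full out-degrees.\<close>
  have no_in: "\<not> u \<rightarrow>\<^bsub>G\<^esub> s" if "s \<in> S" for u s
  proof
    assume "u \<rightarrow>\<^bsub>G\<^esub> s"
    moreover from this have "u \<in> verts G" "s \<in> verts G" by auto
    ultimately have "real (in_degree G s) > 0"
      unfolding in_degree_eq_sum[OF \<open>s \<in> verts G\<close>] by (intro sum_pos2[of _ u]) auto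
    then show False using assms(7)[OF that] by simp
  qed
  \<comment> \<open>Deleting the leader columns removes from row \<open>i\<close> exactly the arcs
    arriving from leaders.\<close>
  have row: "(\<Sum>j<m. a i j) = D i - ?\<Gamma> i" if "i < m" for i
  proof -
    have "D i = (\<Sum>w\<in>verts G - S. of_bool (w \<rightarrow>\<^bsub>G\<^esub> v ! i)) + (\<Sum>w\<in>S. of_bool (w \<rightarrow>\<^bsub>G\<^esub> v ! i))"
      using in_degree_eq_sum[of "v ! i"] follower[OF that]
        sum.subset_diff[OF assms(4) finite_verts, of "\<lambda>w. of_bool (w \<rightarrow>\<^bsub>G\<^esub> v ! i) :: real"]
      by (simp add: D_def)
    moreover have "(\<Sum>w\<in>S. of_bool (w \<rightarrow>\<^bsub>G\<^esub> v ! i)) = ?\<Gamma> i"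
      using finS by (simp add: leader_degree_def of_bool_def sum.If_cases Int_def)
    ultimately show ?thesis
      using sum_list_index_distinct[OF dist, of "\<lambda>w. of_bool (w \<rightarrow>\<^bsub>G\<^esub> v ! i) :: real"]
      by (simp add: a_def m_def setv)
  qed
  have column: "(\<Sum>j<m. a j i) = ?\<delta> i" if "i < m" for i
  proof -
    have "?\<delta> i = (\<Sum>w\<in>verts G - S. of_bool (v ! i \<rightarrow>\<^bsub>G\<^esub> w))"
      using out_degree_eq_sum[of "v ! i"] follower[OF that] no_in
        sum.subset_diff[OF assms(4) finite_verts, of "\<lambda>w. of_bool (v ! i \<rightarrow>\<^bsub>G\<^esub> w) :: real"]
      by simp
    then show ?thesis
      using sum_list_index_distinct[OF dist, of "\<lambda>w. of_bool (v ! i \<rightarrow>\<^bsub>G\<^esub> w) :: real"]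
      by (simp add: a_def m_def setv)
  qed
  have fin: "finite ((f :: nat \<Rightarrow> real) ` {..<m})" and ne: "f ` {..<m} \<noteq> {}" for f
    using m0 by auto

  let ?c = "MIN i\<in>{..<m}. 1 / 2 * (D i - ?\<delta> i + ?\<Gamma> i)"
  have "?c \<le> smallest_singular_value L"
  proof (rule smallest_singular_value_ge[OF L m0])
    fix x :: "real vec" assume x: "x \<in> carrier_vec m"
    show "?c * (x \<bullet> x) \<le> x \<bullet> (L *\<^sub>v x)"
      unfolding L_def
    proof (rule quadratic_form_diagonal_minus_ge[OF _ x])
      fix i assume i: "i < m"
      have "?c \<le> 1 / 2 * (D i - ?\<delta> i + ?\<Gamma> i)"
        using i by (intro Min_le fin) auto
      \<comment> \<open>By \<open>row\<close> and \<open>column\<close> the right-hand side is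
        \<open>D i - (D i - ?\<Gamma> i) / 2 - ?\<delta> i / 2\<close>, which is the expression
        minimized in \<open>?c\<close>.\<close>
      then show "?c \<le> D i - (\<Sum>j<m. a i j) / 2 - (\<Sum>j<m. a j i) / 2"
        by (simp add: row[OF i] column[OF i] field_simps)
    qed (simp add: a_def)
  qed
  moreover have "0 \<le> smallest_singular_value L"
    by (rule smallest_singular_value_nonneg[OF L m0])
  moreover have "smallest_singular_value L \<le> sqrt (1 / real m * (\<Sum>i<m. (?\<Gamma> i)\<^sup>2))"
  proof -
    define e where "e = vec m (\<lambda>_. 1 :: real)"
    have e: "e \<in> carrier_vec m" "e \<bullet> e = real m"
      by (simp_all add: e_def scalar_prod_def)
    have "L *\<^sub>v e = vec m ?\<Gamma>"
      by (intro eq_vecI)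
         (simp_all add: L_def e_def scalar_prod_def atLeast0LessThan sum_subtractf row)
    then have "(L *\<^sub>v e) \<bullet> (L *\<^sub>v e) = (\<Sum>i<m. (?\<Gamma> i)\<^sup>2)"
      by (simp add: scalar_prod_def power2_eq_square atLeast0LessThan)
    then show ?thesis
      using smallest_singular_value_le[OF L e(1)] e(2) m0 by simp
  qed
  moreover have "smallest_singular_value L \<le> sqrt (MIN i\<in>{..<m}. (D i)\<^sup>2 + ?\<delta> i)"
  proof -
    obtain k where k: "k < m" "(MIN i\<in>{..<m}. (D i)\<^sup>2 + ?\<delta> i) = (D k)\<^sup>2 + ?\<delta> k"
      using Min_in[OF fin ne, of "\<lambda>i. (D i)\<^sup>2 + ?\<delta> i"] by auto
    have akk: "a k k = 0"
      by (auto simp: a_def arcs_ends_def arc_to_ends_def) (metis no_loops)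
    let ?e = "unit_vec m k :: real vec"
    have "L *\<^sub>v ?e = col L k"
      using L k(1) by (intro eq_vecI) auto
    then have "(L *\<^sub>v ?e) \<bullet> (L *\<^sub>v ?e) = (\<Sum>i<m. ((if i = k then D i else 0) - a i k)\<^sup>2)"
      using k(1) by (simp add: L_def scalar_prod_def power2_eq_square atLeast0LessThan)
    \<comment> \<open>The cross term vanishes because there are no loops, and the entries
      \<open>a i k\<close>, being 0 or 1, equal their squares. The column sum then supplies the
      out-degree.\<close>
    also have "\<dots> = (\<Sum>i<m. (if i = k then (D i)\<^sup>2 else 0) + a i k)"
    proof (rule sum.cong[OF refl])
      show "((if i = k then D i else 0) - a i k)\<^sup>2 = (if i = k then (D i)\<^sup>2 else 0) + a i k" for i
        using akk by (cases "i = k") (auto simp: a_def)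
    qed
    also have "\<dots> = (D k)\<^sup>2 + ?\<delta> k"
      using k(1) by (simp add: sum.distrib column)
    finally show ?thesis
      using smallest_singular_value_le[OF L, of ?e] k by simp
  qed
  ultimately show ?thesis
    unfolding grounded card D_def by simp
qed

end
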